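(* Let $\mathcal{H} := \operatorname{conv}\{(x, xx^T, y, y_1y_2) : x\in\mathbb{R}^2,\ y\in\{0,1\}^2,\ 0\le x\le y\}$. Then $\mathcal{H}$ equals the projection onto $(x,X,y,Y_{12})$ of the set of all $(x,X,y,Y_{12},\alpha)$ (with $x,y,\alpha\in\mathbb{R}^2$, $X$ a real symmetric $2\times 2$ matrix, $Y_{12}\in\mathbb{R}$) satisfying the convex constraints (i) $\operatorname{diag}(X)\le x\le y$; (ii) $\max\{0,\ x_1-\alpha_1+x_2-\alpha_2-Y_{12}\}\le X_{12}\le \min\{x_1-\alpha_1,\ x_2-\alpha_2\}$; (iii) $0\le\alpha_j\le y_j-Y_{12}$ for $j=1,2$; (iv) $\max\{0,\ y_1+y_2-1\}\le Y_{12}\le\min\{y_1,y_2\}$; (v) $$\begin{pmatrix} Y_{12} & x_1-\alpha_1 & x_2-\alpha_2\\ x_1-\alpha_1 & X_{11}-(y_1-Y_{12})^{-1}\alpha_1^2 & X_{12}\\ x_2-\alpha_2 & X_{12} & X_{22}-(y_2-Y_{12})^{-1}\alpha_2^2\end{pmatrix}\succeq 0.$$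
   Context: Vector inequalities are componentwise; $\operatorname{diag}(X)=(X_{11},X_{22})^T$; $\succeq 0$ means positive semidefinite. A point of $\mathcal{H}$ is written $(x,X,y,Y_{12})$, where $X$ is a symmetric $2\times2$ matrix and $Y_{12}$ is a scalar. The convention $0/0:=0$ is used, so $(y_j-Y_{12})^{-1}\alpha_j^2:=0$ when $y_j-Y_{12}=0$ and $\alpha_j=0$. *)

theory Defs
  imports "HOL-Analysis.Analysis"
begin

definition outer_square :: "real^'n \<Rightarrow> real^'n^'n" where
  "outer_square x = (\<chi> i j. x $ i * x $ j)"

definition diag_vec :: "real^'n^'n \<Rightarrow> real^'n" where
  "diag_vec X = (\<chi> i. X $ i $ i)"

definition symmetric_matrix :: "real^'n^'n \<Rightarrow> bool" where
  "symmetric_matrix A \<longleftrightarrow> transpose A = A"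

definition positive_semidefinite :: "real^'n^'n \<Rightarrow> bool" where
  "positive_semidefinite A \<longleftrightarrow> symmetric_matrix A \<and> (\<forall>v. 0 \<le> v \<bullet> (A *v v))"

(* Points are (x, X, y, Y12).  The order on real^2 is the componentwise one. *)
definition switching_hull :: "((real^2) \<times> (real^2^2) \<times> (real^2) \<times> real) set" where
  "switching_hull = convex hull
     {(x, outer_square x, y, y $ 1 * y $ 2) | x y.
        (\<forall>j. y $ j \<in> {0, 1}) \<and> 0 \<le> x \<and> x \<le> y}"

(* The library convention inverse 0 = 0 gives inverse (y $ j - Y12) * (\<alpha> $ j)^2 = 0
   if y $ j = Y12.  The constraints force \<alpha> $ j = 0 in that case, so this is precisely the
   convention 0/0 = 0; no quotient a/0 with a nonzero is ever involved at a feasible point. *)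
definition switching_matrix ::
  "real^2 \<Rightarrow> real^2^2 \<Rightarrow> real^2 \<Rightarrow> real \<Rightarrow> real^2 \<Rightarrow> real^3^3" where
  "switching_matrix x X y Y12 \<alpha> = vector
     [vector [Y12, x $ 1 - \<alpha> $ 1, x $ 2 - \<alpha> $ 2],
      vector [x $ 1 - \<alpha> $ 1, X $ 1 $ 1 - inverse (y $ 1 - Y12) * (\<alpha> $ 1)\<^sup>2, X $ 1 $ 2],
      vector [x $ 2 - \<alpha> $ 2, X $ 1 $ 2, X $ 2 $ 2 - inverse (y $ 2 - Y12) * (\<alpha> $ 2)\<^sup>2]]"

definition lifted_set ::
  "((real^2) \<times> (real^2^2) \<times> (real^2) \<times> real \<times> (real^2)) set" where
  "lifted_set = {(x, X, y, Y12, \<alpha>).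
     symmetric_matrix X \<and>
     diag_vec X \<le> x \<and> x \<le> y \<and>
     max 0 (x $ 1 - \<alpha> $ 1 + x $ 2 - \<alpha> $ 2 - Y12) \<le> X $ 1 $ 2 \<and>
     X $ 1 $ 2 \<le> min (x $ 1 - \<alpha> $ 1) (x $ 2 - \<alpha> $ 2) \<and>
     (\<forall>j. 0 \<le> \<alpha> $ j \<and> \<alpha> $ j \<le> y $ j - Y12) \<and>
     max 0 (y $ 1 + y $ 2 - 1) \<le> Y12 \<and> Y12 \<le> min (y $ 1) (y $ 2) \<and>
     positive_semidefinite (switching_matrix x X y Y12 \<alpha>)}"

end

theory Submission
  imports Defs
begin

text \<open>
  The lifted set is convex, since \<open>\<alpha>\<^sup>2 / (y - Y)\<close> is a perspective function, and it contains a
  lift of every generator with \<open>\<alpha>\<^sub>j = x\<^sub>j (1 - y\<^sub>i)\<close>, \<open>i \<noteq> j\<close>; this gives one inclusion.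

  Conversely, split a feasible point by the value of \<open>y\<close>, with masses \<open>Y\<close> for \<open>(1, 1)\<close> and
  \<open>w\<^sub>j = y\<^sub>j - Y\<close> for the unit vectors.  The \<open>j\<close>-th unit vector carries first moment
  \<open>\<alpha>\<^sub>j\<close> and some second moment \<open>\<beta>\<^sub>j\<close> between \<open>\<alpha>\<^sub>j\<^sup>2 / w\<^sub>j\<close> and \<open>\<alpha>\<^sub>j\<close>.  The rest must lie in the
  hull of \<open>(x, xx\<^sup>T)\<close> over the unit square, scaled by \<open>Y\<close>; by Anstreicher and Burer this hull is
  cut out by semidefiniteness, the McCormick inequalities and \<open>diag X \<le> x\<close>.  Only the last
  condition can fail, and it can be restored by changing \<open>\<alpha>\<close>.  For the unit square, a law on two
  points of the line through the mean with slope covariance / variance matches all moments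
  except that one of the second moments may be too small, and this one is then raised.
\<close>

section \<open>Semidefiniteness of 3 by 3 matrices as quadratic forms\<close>

text \<open>The arguments list the upper triangle of a symmetric matrix row by row:
  \<open>t u v\<close>, then \<open>P R\<close>, then \<open>Q\<close>.\<close>

definition psd3 :: "real \<Rightarrow> real \<Rightarrow> real \<Rightarrow> real \<Rightarrow> real \<Rightarrow> real \<Rightarrow> bool" where
  "psd3 t u v P R Q \<longleftrightarrow>
     (\<forall>a b c. 0 \<le> t * a\<^sup>2 + P * b\<^sup>2 + Q * c\<^sup>2 + 2 * u * a * b + 2 * v * a * c + 2 * R * b * c)"

lemma psd3_commute: "psd3 t u v P R Q \<longleftrightarrow> psd3 t v u Q R P"
proof -
  have "psd3 t v u Q R P" if "psd3 t u v P R Q" for t u v P R Q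
    unfolding psd3_def
  proof (intro allI)
    fix a b c
    have "0 \<le> t * a\<^sup>2 + P * c\<^sup>2 + Q * b\<^sup>2 + 2 * u * a * c + 2 * v * a * b + 2 * R * c * b"
      using that unfolding psd3_def by blast
    then show "0 \<le> t * a\<^sup>2 + Q * b\<^sup>2 + P * c\<^sup>2 + 2 * v * a * b + 2 * u * a * c + 2 * R * b * c"
      by (simp add: algebra_simps)
  qed
  then show ?thesis by blast
qed

lemma psd3_mono:
  assumes "psd3 t u v P R Q" "P \<le> P'" "Q \<le> Q'"
  shows "psd3 t u v P' R Q'"
  unfolding psd3_def
proof (intro allI)
  fix a b c
  have "0 \<le> t * a\<^sup>2 + P * b\<^sup>2 + Q * c\<^sup>2 + 2 * u * a * b + 2 * v * a * c + 2 * R * b * c"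
    using assms unfolding psd3_def by blast
  moreover have "P * b\<^sup>2 \<le> P' * b\<^sup>2" "Q * c\<^sup>2 \<le> Q' * c\<^sup>2"
    using assms by (auto intro: mult_right_mono)
  ultimately show "0 \<le> t * a\<^sup>2 + P' * b\<^sup>2 + Q' * c\<^sup>2 + 2 * u * a * b + 2 * v * a * c + 2 * R * b * c"
    by linarith
qed

lemma psd3_convex:
  assumes "psd3 t u v P R Q" "psd3 t' u' v' P' R' Q'" "0 \<le> s" "0 \<le> r"
  shows "psd3 (s * t + r * t') (s * u + r * u') (s * v + r * v')
              (s * P + r * P') (s * R + r * R') (s * Q + r * Q')"
  unfolding psd3_def
proof (intro allI)
  fix a b c
  have "0 \<le> s * (t * a\<^sup>2 + P * b\<^sup>2 + Q * c\<^sup>2 + 2 * u * a * b + 2 * v * a * c + 2 * R * b * c)"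
    using assms unfolding psd3_def by simp
  moreover
  have "0 \<le> r * (t' * a\<^sup>2 + P' * b\<^sup>2 + Q' * c\<^sup>2 + 2 * u' * a * b + 2 * v' * a * c + 2 * R' * b * c)"
    using assms unfolding psd3_def by simp
  ultimately show "0 \<le> (s * t + r * t') * a\<^sup>2 + (s * P + r * P') * b\<^sup>2 + (s * Q + r * Q') * c\<^sup>2
      + 2 * (s * u + r * u') * a * b + 2 * (s * v + r * v') * a * c + 2 * (s * R + r * R') * b * c"
    by (simp add: algebra_simps)
qed

lemma psd2_iff:
  fixes A B c :: real
  shows "(\<forall>b d. 0 \<le> A * b\<^sup>2 + 2 * c * b * d + B * d\<^sup>2) \<longleftrightarrow> 0 \<le> A \<and> 0 \<le> B \<and> c\<^sup>2 \<le> A * B"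
proof
  assume *: "\<forall>b d. 0 \<le> A * b\<^sup>2 + 2 * c * b * d + B * d\<^sup>2"
  have A: "0 \<le> A" using *[rule_format, of 1 0] by simp
  have B: "0 \<le> B" using *[rule_format, of 0 1] by simp
  have "c\<^sup>2 \<le> A * B"
  proof (cases "A = 0")
    case True
    \<comment> \<open>With \<open>A = 0\<close> the form takes the value
      \<open>- (B + 2) * c\<^sup>2\<close> at this test vector, which forces
      \<open>c = 0\<close>.\<close>
    have "0 \<le> 2 * c * (- c * (B + 1)) + B * c\<^sup>2"
      using *[rule_format, of "- (B + 1)" c] True by (simp add: algebra_simps)
    then have "(B + 2) * c\<^sup>2 \<le> 0" by (simp add: algebra_simps power2_eq_square)
    then show ?thesis using B True by (simp add: mult_le_0_iff)
  next
    case False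
    then have "A > 0" using A by simp
    have "0 \<le> A * (A * B - c\<^sup>2)"
      using *[rule_format, of "- c" A] by (simp add: algebra_simps power2_eq_square)
    then show ?thesis using \<open>A > 0\<close> by (simp add: zero_le_mult_iff)
  qed
  then show "0 \<le> A \<and> 0 \<le> B \<and> c\<^sup>2 \<le> A * B" using A B by blast
next
  assume *: "0 \<le> A \<and> 0 \<le> B \<and> c\<^sup>2 \<le> A * B"
  show "\<forall>b d. 0 \<le> A * b\<^sup>2 + 2 * c * b * d + B * d\<^sup>2"
  proof (intro allI)
    fix b d
    show "0 \<le> A * b\<^sup>2 + 2 * c * b * d + B * d\<^sup>2"
    proof (cases "A = 0")
      case True
      then show ?thesis using * by simp
    next
      case False
      have "A * (A * b\<^sup>2 + 2 * c * b * d + B * d\<^sup>2) = (A * b + c * d)\<^sup>2 + (A * B - c\<^sup>2) * d\<^sup>2"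
        by (simp add: algebra_simps power2_eq_square)
      also have "\<dots> \<ge> 0" using * by simp
      finally show ?thesis using False * by (simp add: zero_le_mult_iff)
    qed
  qed
qed

text \<open>Completing the square in the first variable leaves a binary form in the other two. Its
  coefficients are the entries of the Schur complement times \<open>t\<close>; for moments on a mass
  \<open>t\<close> they are rescaled variances and a rescaled covariance.\<close>

lemma psd3_iff_schur:
  assumes t: "0 < t"
  shows "psd3 t u v P R Q \<longleftrightarrow>
    0 \<le> t * P - u\<^sup>2 \<and> 0 \<le> t * Q - v\<^sup>2 \<and> (t * R - u * v)\<^sup>2 \<le> (t * P - u\<^sup>2) * (t * Q - v\<^sup>2)"
proof -
  let ?f = "\<lambda>a b c. t * a\<^sup>2 + P * b\<^sup>2 + Q * c\<^sup>2 + 2 * u * a * b + 2 * v * a * c + 2 * R * b * c"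
  let ?g = "\<lambda>b c. (t * P - u\<^sup>2) * b\<^sup>2 + 2 * (t * R - u * v) * b * c + (t * Q - v\<^sup>2) * c\<^sup>2"
  have eq: "t * ?f a b c = (t * a + u * b + v * c)\<^sup>2 + ?g b c" for a b c
    by (simp add: algebra_simps power2_eq_square)
  have "(\<forall>a b c. 0 \<le> ?f a b c) \<longleftrightarrow> (\<forall>b c. 0 \<le> ?g b c)"
  proof (intro iffI allI)
    fix b c assume "\<forall>a b c. 0 \<le> ?f a b c"
    \<comment> \<open>This first argument makes the completed square vanish.\<close>
    then have "0 \<le> t * ?f (- (u * b + v * c) / t) b c"
      using t by (intro mult_nonneg_nonneg) (blast intro: less_imp_le)+
    then show "0 \<le> ?g b c" unfolding eq using t by simp
  next
    fix a b c assume "\<forall>b c. 0 \<le> ?g b c"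
    then have "0 \<le> t * ?f a b c" unfolding eq by simp
    then show "0 \<le> ?f a b c" using t by (simp add: zero_le_mult_iff)
  qed
  then show ?thesis unfolding psd3_def psd2_iff .
qed

lemma positive_semidefinite_switching_matrix:
  "positive_semidefinite (switching_matrix x X y t \<alpha>) \<longleftrightarrow>
   psd3 t (x $ 1 - \<alpha> $ 1) (x $ 2 - \<alpha> $ 2)
     (X $ 1 $ 1 - inverse (y $ 1 - t) * (\<alpha> $ 1)\<^sup>2) (X $ 1 $ 2)
     (X $ 2 $ 2 - inverse (y $ 2 - t) * (\<alpha> $ 2)\<^sup>2)" (is "?L \<longleftrightarrow> psd3 t ?u ?v ?P ?R ?Q")
proof -
  let ?M = "switching_matrix x X y t \<alpha>"
  have sym: "symmetric_matrix ?M"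
    by (simp add: symmetric_matrix_def switching_matrix_def vec_eq_iff transpose_def forall_3)
  have form: "z \<bullet> (?M *v z) =
      t * (z $ 1)\<^sup>2 + ?P * (z $ 2)\<^sup>2 + ?Q * (z $ 3)\<^sup>2 + 2 * ?u * z $ 1 * z $ 2
        + 2 * ?v * z $ 1 * z $ 3 + 2 * ?R * z $ 2 * z $ 3" for z :: "real^3"
    unfolding switching_matrix_def
    by (simp add: inner_vec_def matrix_vector_mult_def sum_3 power2_eq_square algebra_simps)
  show ?thesis
    unfolding positive_semidefinite_def psd3_def form
  proof (intro iffI conjI allI sym)
    fix a b c
    assume "symmetric_matrix ?M \<and> (\<forall>z::real^3. 0 \<le> t * (z $ 1)\<^sup>2 + ?P * (z $ 2)\<^sup>2 + ?Q * (z $ 3)\<^sup>2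
      + 2 * ?u * z $ 1 * z $ 2 + 2 * ?v * z $ 1 * z $ 3 + 2 * ?R * z $ 2 * z $ 3)"
    then show "0 \<le> t * a\<^sup>2 + ?P * b\<^sup>2 + ?Q * c\<^sup>2 + 2 * ?u * a * b + 2 * ?v * a * c + 2 * ?R * b * c"
      by (metis vector_3)
  qed blast
qed

section \<open>Convexity of the lifted set and lifts of the generators\<close>

lemma mem_lifted_set_iff:
  "(x, X, y, t, \<alpha>) \<in> lifted_set \<longleftrightarrow>
     X $ 1 $ 2 = X $ 2 $ 1 \<and> X $ 1 $ 1 \<le> x $ 1 \<and> X $ 2 $ 2 \<le> x $ 2 \<and> x $ 1 \<le> y $ 1 \<and> x $ 2 \<le> y $ 2 \<and>
     0 \<le> X $ 1 $ 2 \<and> x $ 1 - \<alpha> $ 1 + x $ 2 - \<alpha> $ 2 - t \<le> X $ 1 $ 2 \<and>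
     X $ 1 $ 2 \<le> x $ 1 - \<alpha> $ 1 \<and> X $ 1 $ 2 \<le> x $ 2 - \<alpha> $ 2 \<and>
     0 \<le> \<alpha> $ 1 \<and> \<alpha> $ 1 \<le> y $ 1 - t \<and> 0 \<le> \<alpha> $ 2 \<and> \<alpha> $ 2 \<le> y $ 2 - t \<and>
     0 \<le> t \<and> y $ 1 + y $ 2 - 1 \<le> t \<and> t \<le> y $ 1 \<and> t \<le> y $ 2 \<and>
     psd3 t (x $ 1 - \<alpha> $ 1) (x $ 2 - \<alpha> $ 2)
       (X $ 1 $ 1 - inverse (y $ 1 - t) * (\<alpha> $ 1)\<^sup>2) (X $ 1 $ 2)
       (X $ 2 $ 2 - inverse (y $ 2 - t) * (\<alpha> $ 2)\<^sup>2)"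
  unfolding lifted_set_def positive_semidefinite_switching_matrix
  by (auto simp: symmetric_matrix_def diag_vec_def vec_eq_iff transpose_def forall_2
      less_eq_vec_def)

text \<open>In terms of the slopes \<open>z\<close> and \<open>z'\<close>, the gap between the two
  sides, multiplied by \<open>D\<close>, is \<open>(s * w) * (r * w') * (z - z')\<^sup>2\<close>.
  The bounds make \<open>a\<close> vanish together with \<open>w\<close>, so
  \<open>a = w * z\<close> holds even when \<open>inverse w\<close> is the default 0.\<close>

lemma perspective_square_convex:
  fixes a a' w w' s r :: real
  assumes "0 \<le> a" "a \<le> w" "0 \<le> a'" "a' \<le> w'" "0 \<le> s" "0 \<le> r"
  shows "inverse (s * w + r * w') * (s * a + r * a')\<^sup>2
      \<le> s * (inverse w * a\<^sup>2) + r * (inverse w' * a'\<^sup>2)"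
proof -
  define D where "D = s * w + r * w'"
  define z where "z = inverse w * a"
  define z' where "z' = inverse w' * a'"
  have a: "a = w * z" "a' = w' * z'"
    using assms by (cases "w = 0"; cases "w' = 0"; simp add: z_def z'_def)+
  have D0: "0 \<le> D" using assms by (simp add: D_def)
  have q: "inverse w * a\<^sup>2 = w * z\<^sup>2" "inverse w' * a'\<^sup>2 = w' * z'\<^sup>2"
    using assms by (auto simp: z_def z'_def power2_eq_square)
  have nn: "0 \<le> s * w * z\<^sup>2 + r * w' * z'\<^sup>2" using assms by simp
  have "D * (s * w * z\<^sup>2 + r * w' * z'\<^sup>2) - (s * (w * z) + r * (w' * z'))\<^sup>2
      = (s * w) * (r * w') * (z - z')\<^sup>2"
    unfolding D_def by (simp add: algebra_simps power2_eq_square)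
  also have "\<dots> \<ge> 0" using assms by simp
  finally have *: "(s * (w * z) + r * (w' * z'))\<^sup>2 \<le> D * (s * w * z\<^sup>2 + r * w' * z'\<^sup>2)" by simp
  show ?thesis
  proof (cases "D = 0")
    case True
    then show ?thesis unfolding D_def[symmetric] q using nn by (simp add: mult.assoc)
  next
    case False
    then have "D > 0" using D0 by simp
    then show ?thesis
      unfolding D_def[symmetric] q using * a by (simp add: field_simps)
  qed
qed

lemma convex_lifted_set: "convex lifted_set"
proof (rule convexI)
  fix p q :: "(real^2) \<times> (real^2^2) \<times> (real^2) \<times> real \<times> (real^2)" and s r :: real
  assume p: "p \<in> lifted_set" and q: "q \<in> lifted_set" and s: "0 \<le> s" and r: "0 \<le> r" and sr: "s + r = 1"
  obtain x X y t \<alpha> where pe: "p = (x, X, y, t, \<alpha>)" by (metis prod_cases5)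
  obtain x' X' y' t' \<alpha>' where qe: "q = (x', X', y', t', \<alpha>')" by (metis prod_cases5)
  note P = p[unfolded pe mem_lifted_set_iff] and Q = q[unfolded qe mem_lifted_set_iff]
  have lin: "s * a + r * a' \<le> s * b + r * b'" if "a \<le> b" "a' \<le> b'" for a a' b b' :: real
    using that s r by (simp add: add_mono mult_left_mono)
  have "s * (y $ 1 + y $ 2 - 1) + r * (y' $ 1 + y' $ 2 - 1) \<le> s * t + r * t'"
    using P Q by (intro lin) auto
  then have one: "s * y $ 1 + r * y' $ 1 + (s * y $ 2 + r * y' $ 2) - 1 \<le> s * t + r * t'"
    using sr by (simp add: algebra_simps)
  have persp: "inverse (s * y $ j + r * y' $ j - (s * t + r * t')) * (s * \<alpha> $ j + r * \<alpha>' $ j)\<^sup>2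
      \<le> s * (inverse (y $ j - t) * (\<alpha> $ j)\<^sup>2) + r * (inverse (y' $ j - t') * (\<alpha>' $ j)\<^sup>2)"
    if "0 \<le> \<alpha> $ j" "\<alpha> $ j \<le> y $ j - t" "0 \<le> \<alpha>' $ j" "\<alpha>' $ j \<le> y' $ j - t'" for j
    using perspective_square_convex[OF that s r] by (simp add: algebra_simps)
  have psd: "psd3 (s * t + r * t')
      (s * x $ 1 + r * x' $ 1 - (s * \<alpha> $ 1 + r * \<alpha>' $ 1))
      (s * x $ 2 + r * x' $ 2 - (s * \<alpha> $ 2 + r * \<alpha>' $ 2))
      (s * X $ 1 $ 1 + r * X' $ 1 $ 1
        - inverse (s * y $ 1 + r * y' $ 1 - (s * t + r * t')) * (s * \<alpha> $ 1 + r * \<alpha>' $ 1)\<^sup>2)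
      (s * X $ 1 $ 2 + r * X' $ 1 $ 2)
      (s * X $ 2 $ 2 + r * X' $ 2 $ 2
        - inverse (s * y $ 2 + r * y' $ 2 - (s * t + r * t')) * (s * \<alpha> $ 2 + r * \<alpha>' $ 2)\<^sup>2)"
  \<comment> \<open>Compared with the combination of the two matrices, only the last two diagonal
    entries differ, and the perspective inequality makes them larger.\<close>
  proof (rule psd3_mono)
    have "psd3 (s * t + r * t')
      (s * (x $ 1 - \<alpha> $ 1) + r * (x' $ 1 - \<alpha>' $ 1)) (s * (x $ 2 - \<alpha> $ 2) + r * (x' $ 2 - \<alpha>' $ 2))
      (s * (X $ 1 $ 1 - inverse (y $ 1 - t) * (\<alpha> $ 1)\<^sup>2) + r * (X' $ 1 $ 1 - inverse (y' $ 1 - t') * (\<alpha>' $ 1)\<^sup>2))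
      (s * X $ 1 $ 2 + r * X' $ 1 $ 2)
      (s * (X $ 2 $ 2 - inverse (y $ 2 - t) * (\<alpha> $ 2)\<^sup>2) + r * (X' $ 2 $ 2 - inverse (y' $ 2 - t') * (\<alpha>' $ 2)\<^sup>2))"
      using P Q s r by (intro psd3_convex) auto
    moreover have "s * (x $ j - \<alpha> $ j) + r * (x' $ j - \<alpha>' $ j)
        = s * x $ j + r * x' $ j - (s * \<alpha> $ j + r * \<alpha>' $ j)" for j
      by (simp add: algebra_simps)
    ultimately show "psd3 (s * t + r * t')
      (s * x $ 1 + r * x' $ 1 - (s * \<alpha> $ 1 + r * \<alpha>' $ 1))
      (s * x $ 2 + r * x' $ 2 - (s * \<alpha> $ 2 + r * \<alpha>' $ 2))
      (s * (X $ 1 $ 1 - inverse (y $ 1 - t) * (\<alpha> $ 1)\<^sup>2) + r * (X' $ 1 $ 1 - inverse (y' $ 1 - t') * (\<alpha>' $ 1)\<^sup>2))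
      (s * X $ 1 $ 2 + r * X' $ 1 $ 2)
      (s * (X $ 2 $ 2 - inverse (y $ 2 - t) * (\<alpha> $ 2)\<^sup>2) + r * (X' $ 2 $ 2 - inverse (y' $ 2 - t') * (\<alpha>' $ 2)\<^sup>2))"
      by simp
  next
    show "s * (X $ 1 $ 1 - inverse (y $ 1 - t) * (\<alpha> $ 1)\<^sup>2) + r * (X' $ 1 $ 1 - inverse (y' $ 1 - t') * (\<alpha>' $ 1)\<^sup>2)
      \<le> s * X $ 1 $ 1 + r * X' $ 1 $ 1
        - inverse (s * y $ 1 + r * y' $ 1 - (s * t + r * t')) * (s * \<alpha> $ 1 + r * \<alpha>' $ 1)\<^sup>2"
      using persp[of 1] P Q by (simp add: right_diff_distrib)
    show "s * (X $ 2 $ 2 - inverse (y $ 2 - t) * (\<alpha> $ 2)\<^sup>2) + r * (X' $ 2 $ 2 - inverse (y' $ 2 - t') * (\<alpha>' $ 2)\<^sup>2)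
      \<le> s * X $ 2 $ 2 + r * X' $ 2 $ 2
        - inverse (s * y $ 2 + r * y' $ 2 - (s * t + r * t')) * (s * \<alpha> $ 2 + r * \<alpha>' $ 2)\<^sup>2"
      using persp[of 2] P Q by (simp add: right_diff_distrib)
  qed
  have lin_diff: "s * a + r * a' \<le> s * b + r * b' - (s * c + r * c')"
    if "a \<le> b - c" "a' \<le> b' - c'" for a a' b b' c c' :: real
    using lin[OF that] by (simp add: algebra_simps)
  have "s * (x $ 1 - \<alpha> $ 1 + x $ 2 - \<alpha> $ 2 - t) + r * (x' $ 1 - \<alpha>' $ 1 + x' $ 2 - \<alpha>' $ 2 - t')
      \<le> s * X $ 1 $ 2 + r * X' $ 1 $ 2"
    using P Q by (intro lin) auto
  then have mc: "s * x $ 1 + r * x' $ 1 - (s * \<alpha> $ 1 + r * \<alpha>' $ 1)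
      + (s * x $ 2 + r * x' $ 2) - (s * \<alpha> $ 2 + r * \<alpha>' $ 2) - (s * t + r * t')
      \<le> s * X $ 1 $ 2 + r * X' $ 1 $ 2"
    by (simp add: algebra_simps)
  have nonneg: "0 \<le> s * a + r * a'" if "0 \<le> a" "0 \<le> a'" for a a' :: real
    using that s r by simp
  show "s *\<^sub>R p + r *\<^sub>R q \<in> lifted_set"
    unfolding pe qe scaleR_Pair add_Pair mem_lifted_set_iff
      vector_add_component vector_scaleR_component real_scaleR_def
  proof (intro conjI)
    show "s * X $ 1 $ 2 + r * X' $ 1 $ 2 = s * X $ 2 $ 1 + r * X' $ 2 $ 1" using P Q by simp
  qed ((rule psd one mc)
      | (rule lin, (use P in blast), (use Q in blast))
      | (rule lin_diff, (use P in blast), (use Q in blast))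
      | (rule nonneg, (use P in blast), (use Q in blast)))+
qed

lemma switching_hull_subset:
  "switching_hull \<subseteq> (\<lambda>(x, X, y, Y12, \<alpha>). (x, X, y, Y12)) ` lifted_set"
  unfolding switching_hull_def
proof (rule hull_minimal)
  let ?f = "(\<lambda>(x, X, y, Y12, \<alpha>). (x, X, y, Y12))
    :: (real^2) \<times> (real^2^2) \<times> (real^2) \<times> real \<times> (real^2) \<Rightarrow> (real^2) \<times> (real^2^2) \<times> (real^2) \<times> real"
  have "linear ?f" by (rule linearI) auto
  then show "convex (?f ` lifted_set)" using convex_lifted_set by (rule convex_linear_image)
  show "{(x, outer_square x, y, y $ 1 * y $ 2) | x y. (\<forall>j. y $ j \<in> {0, 1}) \<and> 0 \<le> x \<and> x \<le> y}
      \<subseteq> ?f ` lifted_set"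
  proof safe
    fix x y :: "real^2"
    assume y: "\<forall>j. y $ j \<in> {0, 1}" and x: "0 \<le> x" "x \<le> y"
    define \<alpha> :: "real^2" where "\<alpha> = vector [x $ 1 * (1 - y $ 2), x $ 2 * (1 - y $ 1)]"
    have x': "0 \<le> x $ 1" "0 \<le> x $ 2" "x $ 1 \<le> y $ 1" "x $ 2 \<le> y $ 2"
      using x by (auto simp: less_eq_vec_def)
    have unit: "a * b \<le> a" "a * b \<le> b" "a + b - 1 \<le> a * b"
      if "0 \<le> a" "0 \<le> b" "a \<le> 1" "b \<le> 1" for a b :: real
    proof -
      show "a * b \<le> a" "a * b \<le> b"
        using that by (auto intro: mult_left_le mult_left_le_one_le)
      have "0 \<le> (1 - a) * (1 - b)" using that by simp
      then show "a + b - 1 \<le> a * b" by (simp add: algebra_simps)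
    qed
    \<comment> \<open>For \<open>y = (1, 1)\<close> the matrix is the rank-one square of
      \<open>(1, a, b)\<close>; for the other three values of \<open>y\<close> it is zero.\<close>
    have psd: "psd3 1 a b (a * a) (a * b) (b * b)" for a b
      by (subst psd3_iff_schur) (auto simp: power2_eq_square)
    have psd0: "psd3 0 0 0 0 0 0" by (simp add: psd3_def)
    have "y $ 1 = 0 \<or> y $ 1 = 1" "y $ 2 = 0 \<or> y $ 2 = 1" using y by auto
    then have "(x, outer_square x, y, y $ 1 * y $ 2, \<alpha>) \<in> lifted_set"
      unfolding mem_lifted_set_iff \<alpha>_def outer_square_def vector_2
      using x' unit[of "x $ 1" "x $ 1"] unit[of "x $ 2" "x $ 2"] unit[of "x $ 1" "x $ 2"]
      by (elim disjE) (auto simp: power2_eq_square psd psd0)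
    then show "(x, outer_square x, y, y $ 1 * y $ 2) \<in> ?f ` lifted_set" by force
  qed
qed

section \<open>The hull in scalar coordinates\<close>

definition switching_point ::
  "real \<Rightarrow> real \<Rightarrow> real \<Rightarrow> real \<Rightarrow> real \<Rightarrow> real \<Rightarrow> real \<Rightarrow> real
    \<Rightarrow> (real^2) \<times> (real^2^2) \<times> (real^2) \<times> real" where
  "switching_point x1 x2 X11 X12 X22 y1 y2 t =
     (vector [x1, x2], vector [vector [X11, X12], vector [X12, X22]], vector [y1, y2], t)"

lemma switching_point_add:
  "switching_point x1 x2 X11 X12 X22 y1 y2 t + switching_point x1' x2' X11' X12' X22' y1' y2' t'
   = switching_point (x1 + x1') (x2 + x2') (X11 + X11') (X12 + X12') (X22 + X22')
       (y1 + y1') (y2 + y2') (t + t')"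
  by (simp add: switching_point_def vec_eq_iff forall_2)

lemma switching_point_scaleR:
  "s *\<^sub>R switching_point x1 x2 X11 X12 X22 y1 y2 t
   = switching_point (s * x1) (s * x2) (s * X11) (s * X12) (s * X22) (s * y1) (s * y2) (s * t)"
  by (simp add: switching_point_def vec_eq_iff forall_2)

lemma switching_hull_convexD:
  "\<lbrakk>p \<in> switching_hull; q \<in> switching_hull; 0 \<le> s; 0 \<le> r; s + r = 1\<rbrakk>
    \<Longrightarrow> s *\<^sub>R p + r *\<^sub>R q \<in> switching_hull"
  unfolding switching_hull_def by (rule convexD[OF convex_convex_hull])

lemma switching_point_generator:
  assumes "y1 \<in> {0, 1}" "y2 \<in> {0, 1}" "0 \<le> x1" "x1 \<le> y1" "0 \<le> x2" "x2 \<le> y2"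
  shows "switching_point x1 x2 (x1\<^sup>2) (x1 * x2) (x2\<^sup>2) y1 y2 (y1 * y2) \<in> switching_hull"
  unfolding switching_hull_def
proof (rule hull_inc, intro CollectI exI conjI)
  show "switching_point x1 x2 (x1\<^sup>2) (x1 * x2) (x2\<^sup>2) y1 y2 (y1 * y2) =
    (vector [x1, x2], outer_square (vector [x1, x2]), vector [y1, y2],
     (vector [y1, y2] :: real^2) $ 1 * (vector [y1, y2] :: real^2) $ 2)"
    by (simp add: switching_point_def outer_square_def vec_eq_iff forall_2 power2_eq_square)
qed (use assms in \<open>auto simp: less_eq_vec_def forall_2\<close>)

section \<open>Hull membership for a fixed value of y\<close>

lemma affine_parameter:
  fixes a b c :: real
  assumes "a \<le> c" "c \<le> b"
  obtains \<theta> where "0 \<le> \<theta>" "\<theta> \<le> 1" "c = (1 - \<theta>) * a + \<theta> * b"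
proof (cases "a = b")
  case True
  then show ?thesis using that[of 0] assms by simp
next
  case False
  then have "a < b" using assms by simp
  then have "(c - a) / (b - a) * (b - a) = c - a" by simp
  then have "c = (1 - (c - a) / (b - a)) * a + (c - a) / (b - a) * b"
    by (simp add: left_diff_distrib right_diff_distrib)
  moreover have "0 \<le> (c - a) / (b - a)" "(c - a) / (b - a) \<le> 1"
    using assms \<open>a < b\<close> by simp_all
  ultimately show ?thesis using that by blast
qed

text \<open>Replacing a coordinate value \<open>s\<close> by the Bernoulli distribution on \<open>{0, 1}\<close> with mean \<open>s\<close>
  raises its second moment from \<open>s\<^sup>2\<close> to \<open>s\<close> and keeps the mixed moments.\<close>

lemma switching_point_diag:
  assumes y: "y1 \<in> {0, 1}" "y2 \<in> {0, 1}"
    and x: "0 \<le> x1" "x1 \<le> y1" "0 \<le> x2" "x2 \<le> y2"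
    and P: "x1\<^sup>2 \<le> P" "P \<le> x1" and Q: "x2\<^sup>2 \<le> Q" "Q \<le> x2"
  shows "switching_point x1 x2 P (x1 * x2) Q y1 y2 (y1 * y2) \<in> switching_hull"
proof -
  have xy: "x1 * y1 = x1" "x2 * y2 = x2" and le1: "x1 \<le> 1" "x2 \<le> 1" using x y by auto
  have y_sq: "y1\<^sup>2 = y1" "y2\<^sup>2 = y2" and y0: "0 \<le> y1" "0 \<le> y2" using y by auto
  \<comment> \<open>The first coordinate is spread while the second sits at a sharp value
    \<open>z\<close>, left free so that the second can be spread afterwards.\<close>
  have first: "switching_point x1 z P' (x1 * z) (z\<^sup>2) y1 y2 (y1 * y2) \<in> switching_hull"
    if z: "0 \<le> z" "z \<le> y2" and P': "x1\<^sup>2 \<le> P'" "P' \<le> x1" for z P'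
  proof -
    obtain \<theta> where \<theta>: "0 \<le> \<theta>" "\<theta> \<le> 1" "P' = (1 - \<theta>) * x1\<^sup>2 + \<theta> * x1"
      using affine_parameter[OF P'] by blast
    \<comment> \<open>The upper support point is \<open>y1\<close> rather than 1, so that it remains
      feasible for \<open>y1 = 0\<close>; then \<open>x1 = 0\<close> and it has no weight.\<close>
    have "(1 - x1) *\<^sub>R switching_point 0 z (0\<^sup>2) (0 * z) (z\<^sup>2) y1 y2 (y1 * y2)
        + x1 *\<^sub>R switching_point y1 z (y1\<^sup>2) (y1 * z) (z\<^sup>2) y1 y2 (y1 * y2) \<in> switching_hull"
      using y x z y0 le1 by (intro switching_hull_convexD switching_point_generator) auto
    also have "(1 - x1) *\<^sub>R switching_point 0 z (0\<^sup>2) (0 * z) (z\<^sup>2) y1 y2 (y1 * y2)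
        + x1 *\<^sub>R switching_point y1 z (y1\<^sup>2) (y1 * z) (z\<^sup>2) y1 y2 (y1 * y2)
        = switching_point x1 z x1 (x1 * z) (z\<^sup>2) y1 y2 (y1 * y2)"
      unfolding switching_point_add switching_point_scaleR y_sq mult.assoc[symmetric] xy
      by (simp add: left_diff_distrib mult.assoc[symmetric] xy)
    finally have "(1 - \<theta>) *\<^sub>R switching_point x1 z (x1\<^sup>2) (x1 * z) (z\<^sup>2) y1 y2 (y1 * y2)
        + \<theta> *\<^sub>R switching_point x1 z x1 (x1 * z) (z\<^sup>2) y1 y2 (y1 * y2) \<in> switching_hull"
      using y x z \<theta> by (intro switching_hull_convexD switching_point_generator) auto
    then show ?thesis
      unfolding \<theta>(3) switching_point_add switching_point_scaleR
      by (simp add: algebra_simps)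
  qed
  obtain \<theta> where \<theta>: "0 \<le> \<theta>" "\<theta> \<le> 1" "Q = (1 - \<theta>) * x2\<^sup>2 + \<theta> * x2"
    using affine_parameter[OF Q] by blast
  have "(1 - x2) *\<^sub>R switching_point x1 0 P (x1 * 0) (0\<^sup>2) y1 y2 (y1 * y2)
      + x2 *\<^sub>R switching_point x1 y2 P (x1 * y2) (y2\<^sup>2) y1 y2 (y1 * y2) \<in> switching_hull"
    using x y0 le1 P by (intro switching_hull_convexD first) auto
  also have "(1 - x2) *\<^sub>R switching_point x1 0 P (x1 * 0) (0\<^sup>2) y1 y2 (y1 * y2)
      + x2 *\<^sub>R switching_point x1 y2 P (x1 * y2) (y2\<^sup>2) y1 y2 (y1 * y2)
      = switching_point x1 x2 P (x1 * x2) x2 y1 y2 (y1 * y2)"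
    unfolding switching_point_add switching_point_scaleR
    using y(2) x by (auto simp: algebra_simps)
  finally have "(1 - \<theta>) *\<^sub>R switching_point x1 x2 P (x1 * x2) (x2\<^sup>2) y1 y2 (y1 * y2)
      + \<theta> *\<^sub>R switching_point x1 x2 P (x1 * x2) x2 y1 y2 (y1 * y2) \<in> switching_hull"
    using x P \<theta> by (intro switching_hull_convexD first) auto
  then show ?thesis
    unfolding \<theta>(3) switching_point_add switching_point_scaleR
    by (simp add: algebra_simps)
qed

text \<open>The law supported at \<open>(u - p, v - m p)\<close> and \<open>(u + q, v + m q)\<close> with weights
  \<open>q / (p + q)\<close> and \<open>p / (p + q)\<close> has mean \<open>(u, v)\<close>, covariance \<open>m p q\<close> and variances
  \<open>p q\<close> and \<open>m\<^sup>2 p q\<close>.\<close>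

lemma two_point_mem_switching_hull:
  assumes p: "0 < p" and q: "0 < q"
    and box: "p \<le> u" "q \<le> 1 - u" "0 \<le> v - m * p" "v - m * p \<le> 1" "0 \<le> v + m * q" "v + m * q \<le> 1"
    and Q: "v\<^sup>2 + m\<^sup>2 * (p * q) \<le> Q" "Q \<le> v"
  shows "switching_point u v (u\<^sup>2 + p * q) (u * v + m * (p * q)) Q 1 1 1 \<in> switching_hull"
proof -
  define l r where "l = q / (p + q)" and "r = p / (p + q)"
  have lr: "0 \<le> l" "0 \<le> r" "l + r = 1" "l * p = r * q"
    using p q by (auto simp: l_def r_def add_divide_distrib[symmetric] mult.commute)
  have l: "l = 1 - r" using lr by simp
  have rpq: "r * q = p - r * p" using lr(4) unfolding l by (simp add: algebra_simps)
  obtain \<theta> where \<theta>: "0 \<le> \<theta>" "\<theta> \<le> 1" "Q = (1 - \<theta>) * (v\<^sup>2 + m\<^sup>2 * (p * q)) + \<theta> * v"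
    using affine_parameter[OF Q] by blast
  define z1 z2 where "z1 = v - m * p" and "z2 = v + m * q"
  have sq_le: "z\<^sup>2 \<le> z" if "0 \<le> z" "z \<le> 1" for z :: real
    using that by (simp add: power2_eq_square mult_left_le)
  \<comment> \<open>Both support points move their second moment the same fraction \<theta> of the
    way from the square to the value itself, so the average moves that fraction from
    \<open>v\<^sup>2 + m\<^sup>2 * (p * q)\<close> to \<open>v\<close>.\<close>
  define Q1 Q2 where "Q1 = (1 - \<theta>) * z1\<^sup>2 + \<theta> * z1" and "Q2 = (1 - \<theta>) * z2\<^sup>2 + \<theta> * z2"
  have z: "0 \<le> z1" "z1 \<le> 1" "0 \<le> z2" "z2 \<le> 1" using box by (auto simp: z1_def z2_def)
  have between: "a \<le> (1 - \<theta>) * a + \<theta> * b" "(1 - \<theta>) * a + \<theta> * b \<le> b" if "a \<le> b" for a b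
  proof -
    have "\<theta> * a \<le> \<theta> * b" "(1 - \<theta>) * a \<le> (1 - \<theta>) * b"
      using that \<theta> by (auto intro: mult_left_mono)
    then show "a \<le> (1 - \<theta>) * a + \<theta> * b" "(1 - \<theta>) * a + \<theta> * b \<le> b"
      by (auto simp: algebra_simps)
  qed
  have "switching_point (u - p) z1 ((u - p)\<^sup>2) ((u - p) * z1) Q1 1 1 (1 * 1) \<in> switching_hull"
    using box p q z between[OF sq_le[OF z(1,2)]] sq_le[of "u - p"]
    by (intro switching_point_diag) (auto simp: Q1_def)
  moreover
  have "switching_point (u + q) z2 ((u + q)\<^sup>2) ((u + q) * z2) Q2 1 1 (1 * 1) \<in> switching_hull"
    using box p q z between[OF sq_le[OF z(3,4)]] sq_le[of "u + q"]
    by (intro switching_point_diag) (auto simp: Q2_def)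
  ultimately have "l *\<^sub>R switching_point (u - p) z1 ((u - p)\<^sup>2) ((u - p) * z1) Q1 1 1 (1 * 1)
    + r *\<^sub>R switching_point (u + q) z2 ((u + q)\<^sup>2) ((u + q) * z2) Q2 1 1 (1 * 1) \<in> switching_hull"
    using lr by (intro switching_hull_convexD)
  moreover have mean: "l * (a - k * p) + r * (a + k * q) = a" for a k
  proof -
    have "l * (a - k * p) + r * (a + k * q) = (l + r) * a - k * (l * p - r * q)"
      by (simp add: algebra_simps)
    then show ?thesis using lr by simp
  qed
  moreover have mixed: "l * ((a - k * p) * (b - n * p)) + r * ((a + k * q) * (b + n * q))
      = a * b + k * n * (p * q)" for a b k n
  proof -
    have "l * ((a - k * p) * (b - n * p)) + r * ((a + k * q) * (b + n * q))
      = (l + r) * (a * b) - (a * n + b * k) * (l * p - r * q) + k * n * (l * p * p + r * q * q)"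
      by (simp add: algebra_simps)
    also have "l * p * p + r * q * q = (l + r) * (p * q)"
      using lr(4) by (simp add: algebra_simps)
    finally show ?thesis using lr by simp
  qed
  moreover have "l * Q1 + r * Q2 = Q"
  proof -
    have "l * Q1 + r * Q2 = (1 - \<theta>) * (l * (z1 * z1) + r * (z2 * z2)) + \<theta> * (l * z1 + r * z2)"
      unfolding Q1_def Q2_def by (simp add: algebra_simps power2_eq_square)
    then show ?thesis
      unfolding \<theta>(3) z1_def z2_def mixed mean by (simp add: power2_eq_square)
  qed
  ultimately show ?thesis
    using lr(3) mean[of u 1] mixed[of u 1 u 1] mean[of v m] mixed[of u 1 v m]
    by (simp add: switching_point_add switching_point_scaleR z1_def z2_def power2_eq_square)
qed

text \<open>With zero covariance \<open>c\<close>, independent coordinates suffice. Otherwise take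
  slope \<open>m = c / A\<close> and \<open>q = A / p\<close>: the first variance and the covariance
  are then exact, and the second variance \<open>m\<^sup>2 * A\<close> is at most \<open>B\<close>.
  Choosing \<open>p\<close> as large as the square permits puts the left point on the boundary, and
  the moment bounds keep the right point inside.\<close>

lemma box_hull:
  assumes psd: "psd3 1 u v P R Q"
    and PQ: "P \<le> u" "Q \<le> v"
    and R: "0 \<le> R" "u + v - 1 \<le> R" "R \<le> u" "R \<le> v"
  shows "switching_point u v P R Q 1 1 1 \<in> switching_hull"
proof -
  define A B c where "A = P - u\<^sup>2" and "B = Q - v\<^sup>2" and "c = R - u * v"
  have AB: "0 \<le> A" "0 \<le> B" "c\<^sup>2 \<le> A * B"
    using psd unfolding psd3_iff_schur[OF zero_less_one] by (auto simp: A_def B_def c_def)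
  have uv: "0 \<le> u" "u \<le> 1" "0 \<le> v" "v \<le> 1" using R by auto
  have Av: "A \<le> u * (1 - u)" and Bv: "B \<le> v * (1 - v)"
    using PQ by (auto simp: A_def B_def algebra_simps power2_eq_square)
  show ?thesis
  proof (cases "c = 0")
    case True
    then show ?thesis
      using switching_point_diag[of 1 1 u v P Q] uv PQ AB by (simp add: A_def B_def c_def)
  next
    case False
    then have "0 < A * B" using AB(3) by (smt (verit) zero_less_power2)
    then have A: "0 < A" and B: "0 < B" using AB by (auto simp: zero_less_mult_iff)
    have u: "0 < u" "0 < 1 - u" and v: "0 < v" "0 < 1 - v"
      using Av Bv A B uv by (auto simp: less_le)
    define m where "m = c / A"
    have mA: "m * A = c" using A by (simp add: m_def)
    have m2A: "m\<^sup>2 * A \<le> B"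
      using AB(3) A by (simp add: m_def power2_eq_square field_simps)
    \<comment> \<open>The McCormick inequalities, rewritten as bounds on the covariance.\<close>
    have cR: "c \<le> u * (1 - v)" "c \<le> v * (1 - u)" "- c \<le> u * v" "- c \<le> (1 - u) * (1 - v)"
      using R by (auto simp: c_def algebra_simps)
    have main: ?thesis if p: "0 < p" and box: "p \<le> u" "A / p \<le> 1 - u" "0 \<le> v - m * p" "v - m * p \<le> 1"
      "0 \<le> v + m * (A / p)" "v + m * (A / p) \<le> 1" for p
    proof -
      have "switching_point u v (u\<^sup>2 + p * (A / p)) (u * v + m * (p * (A / p))) Q 1 1 1 \<in> switching_hull"
        using p box A m2A PQ by (intro two_point_mem_switching_hull) (auto simp: B_def)
      then show ?thesis using p mA by (simp add: A_def c_def)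
    qed
    have eq: "m * (A / p) = c / p" for p using mA by simp
    have m2c: "m * c \<le> B" using m2A mA by (simp add: power2_eq_square mult.assoc)
    show ?thesis
    proof (cases "c > 0")
      case c: True
      then have m: "0 < m" using A by (simp add: m_def)
      show ?thesis
      \<comment> \<open>Going left from the mean, a line of positive slope leaves the square through
        the left edge, at \<open>p = u\<close>, or through the bottom edge, at
        \<open>p = v / m\<close>.\<close>
      proof (cases "u \<le> v / m")
        case True
        show ?thesis
        proof (rule main[OF u(1)])
          show "A / u \<le> 1 - u" using Av u by (simp add: field_simps)
          show "0 \<le> v - m * u" using True m by (simp add: field_simps)
          show "v - m * u \<le> 1" using uv m by (smt (verit) mult_nonneg_nonneg)
          show "0 \<le> v + m * (A / u)" using uv m A by simp
          show "v + m * (A / u) \<le> 1" unfolding eq using cR u by (simp add: field_simps)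
        qed simp
      next
        case False
        show ?thesis
        proof (rule main[of "v / m"])
          show "0 < v / m" using v m by simp
          show "v / m \<le> u" using False by simp
          show "A / (v / m) \<le> 1 - u" using cR mA v m by (simp add: field_simps)
          show "0 \<le> v - m * (v / m)" "v - m * (v / m) \<le> 1" using m by auto
          have "m * (A / (v / m)) = m * c / v" unfolding eq by simp
          also have "\<dots> \<le> 1 - v" using m2c Bv v by (simp add: field_simps)
          finally show "v + m * (A / (v / m)) \<le> 1" by simp
          show "0 \<le> v + m * (A / (v / m))" using v m A by simp
        qed
      qed
    next
      case False
      then have c: "c < 0" using \<open>c \<noteq> 0\<close> by simp
      then have m: "m < 0" using A by (simp add: m_def divide_less_0_iff)
      show ?thesis
      \<comment> \<open>For negative slope the exit is through the left edge or the top
        edge.\<close>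
      proof (cases "u \<le> (1 - v) / (- m)")
        case True
        show ?thesis
        proof (rule main[OF u(1)])
          show "A / u \<le> 1 - u" using Av u by (simp add: field_simps)
          show "v - m * u \<le> 1" using True m by (simp add: field_simps)
          show "0 \<le> v - m * u" using uv m by (smt (verit) mult_nonpos_nonneg)
          show "v + m * (A / u) \<le> 1" unfolding eq using c u v
            by (smt (verit) divide_neg_pos)
          show "0 \<le> v + m * (A / u)" unfolding eq using cR u by (simp add: field_simps)
        qed simp
      next
        case False
        define w where "w = 1 - v"
        define n where "n = - m"
        have w: "0 < w" and n: "0 < n" and vw: "v = 1 - w" and mn: "m = - n"
          using v m by (auto simp: w_def n_def)
        have nA: "n * A \<le> (1 - u) * w" and nc: "n * (n * A) \<le> w * v"
          using cR(4) mA m2c Bv by (auto simp: w_def n_def mult.commute)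
        show ?thesis
        proof (rule main[of "w / n"])
          show "0 < w / n" using w n by simp
          show "w / n \<le> u" using False by (simp add: w_def n_def)
          show "A / (w / n) \<le> 1 - u" using nA w n by (simp add: field_simps)
          show "0 \<le> v - m * (w / n)" "v - m * (w / n) \<le> 1" using n by (auto simp: mn vw)
          have "n * (A / (w / n)) = n * (n * A) / w" by simp
          also have "\<dots> \<le> v" using nc w by (simp add: field_simps)
          finally show "0 \<le> v + m * (A / (w / n))" by (simp add: mn)
          have "0 \<le> n * (A / (w / n))" using w n A by simp
          then show "v + m * (A / (w / n)) \<le> 1" using v by (simp add: mn)
        qed
      qed
    qed
  qed
qed

section \<open>Moving first moment between (1, 1) and a unit vector\<close>

text \<open>Lowering the first moment from \<open>u\<close> to \<open>u'\<close>, with second moment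
  then set to \<open>u'\<close>, preserves the determinant condition. Since \<open>R\<close> is
  nonnegative, the covariance shrinks at least by the factor \<open>u' / u\<close>, while the new
  variance term is at least \<open>(u' / u)\<^sup>2 * A\<close>; the latter rests on the remainder
  \<open>t * u' * (u - u')\<^sup>2\<close>.\<close>

lemma schur_shift_down:
  fixes t :: real
  assumes t: "0 < t" and u: "0 \<le> u'" "u' \<le> u" "0 < u" and R: "0 \<le> R" "t * R \<le> u' * v"
    and A: "A \<le> t * (2 * u - u') - u\<^sup>2" and B: "0 \<le> B" and c: "(t * R - u * v)\<^sup>2 \<le> A * B"
  shows "(t * R - u' * v)\<^sup>2 \<le> (t * u' - u'\<^sup>2) * B"
proof -
  have "t * R * u' \<le> t * R * u" using t u R by (intro mult_left_mono) auto
  then have "u * (u' * v - t * R) \<le> u' * (u * v - t * R)" by (simp add: algebra_simps)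
  then have "(u * (u' * v - t * R))\<^sup>2 \<le> (u' * (u * v - t * R))\<^sup>2"
    using u R by (intro power_mono) auto
  then have "u\<^sup>2 * (t * R - u' * v)\<^sup>2 \<le> u'\<^sup>2 * (t * R - u * v)\<^sup>2"
    by (simp add: power_mult_distrib power2_commute)
  also have "\<dots> \<le> u'\<^sup>2 * (A * B)" using c by (intro mult_left_mono) auto
  also have "\<dots> \<le> u\<^sup>2 * ((t * u' - u'\<^sup>2) * B)"
  proof -
    have "u\<^sup>2 * (t * u' - u'\<^sup>2) - u'\<^sup>2 * (t * (2 * u - u') - u\<^sup>2) = t * u' * (u - u')\<^sup>2"
      by (simp add: algebra_simps power2_eq_square)
    also have "\<dots> \<ge> 0" using t u by simp
    finally have "u'\<^sup>2 * (t * (2 * u - u') - u\<^sup>2) \<le> u\<^sup>2 * (t * u' - u'\<^sup>2)" by simp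
    moreover have "u'\<^sup>2 * A \<le> u'\<^sup>2 * (t * (2 * u - u') - u\<^sup>2)" using A by (intro mult_left_mono) auto
    ultimately have "u'\<^sup>2 * A * B \<le> u\<^sup>2 * (t * u' - u'\<^sup>2) * B" using B by (intro mult_right_mono) auto
    then show ?thesis by (simp add: mult.assoc)
  qed
  finally show ?thesis using u by simp
qed

text \<open>The reflection \<open>u \<mapsto> t - u\<close>, \<open>R \<mapsto> v - R\<close> reduces this to the previous lemma.\<close>

lemma schur_shift_up:
  fixes t :: real
  assumes t: "0 < t" and u: "u \<le> u'" "u' \<le> t" "u < t" and R: "R \<le> v" "u' * v \<le> t * R"
    and A: "A \<le> t * u' - u\<^sup>2" and B: "0 \<le> B" and c: "(t * R - u * v)\<^sup>2 \<le> A * B"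
  shows "(t * R - u' * v)\<^sup>2 \<le> (t * u' - u'\<^sup>2) * B"
proof -
  have cov: "(t * (v - R) - (t - z) * v)\<^sup>2 = (t * R - z * v)\<^sup>2" for z
    by (simp add: algebra_simps power2_commute)
  have "(t * (v - R) - (t - u') * v)\<^sup>2 \<le> (t * (t - u') - (t - u')\<^sup>2) * B"
  proof (rule schur_shift_down[OF t])
    show "A \<le> t * (2 * (t - u) - (t - u')) - (t - u)\<^sup>2"
      using A by (simp add: algebra_simps power2_eq_square)
    show "(t * (v - R) - (t - u) * v)\<^sup>2 \<le> A * B" unfolding cov by (rule c)
    show "t * (v - R) \<le> (t - u') * v" using R by (simp add: algebra_simps)
  qed (use u R B in auto)
  then show ?thesis unfolding cov by (simp add: algebra_simps power2_eq_square)
qed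

text \<open>The mass \<open>\<beta>\<close> is the share of \<open>X\<close> carried by the points with only this switch on.  If the
  smallest choice \<open>\<beta> = a\<^sup>2 / w\<close> leaves too large a second moment on the remaining mass \<open>t\<close>, move
  \<open>a\<close> so as to decrease \<open>\<bar>t R - (x - a) v\<bar>\<close>, until either this covariance vanishes or the excess
  \<open>X - a\<^sup>2 / w - (x - a)\<close>, which is nonpositive at \<open>a = 0\<close> and \<open>a = w\<close>, does.\<close>

lemma shift_switch_mass:
  assumes a: "0 \<le> a" "a \<le> w" and Xx: "X \<le> x" and t: "0 \<le> t"
    and R: "0 \<le> R" "x - a + v - t \<le> R" "R \<le> x - a" "R \<le> v"
    and psd: "psd3 t (x - a) v (X - inverse w * a\<^sup>2) R Q"
  obtains a' \<beta> where "0 \<le> a'" "a' \<le> w" "a'\<^sup>2 \<le> w * \<beta>" "0 \<le> \<beta>" "\<beta> \<le> a'" "X - \<beta> \<le> x - a'"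
    "x - a' + v - t \<le> R" "R \<le> x - a'" "psd3 t (x - a') v (X - \<beta>) R Q"
proof -
  note result = that
  define e where "e z = X - z\<^sup>2 / w - (x - z)" for z
  have w: "0 \<le> w" using a by simp
  have inv: "inverse w * a\<^sup>2 = a\<^sup>2 / w" by (simp add: divide_inverse mult.commute)
  show thesis
  proof (cases "e a \<le> 0")
    case True
    have "a\<^sup>2 / w \<le> a" "a\<^sup>2 \<le> w * (a\<^sup>2 / w)"
      using a by (cases "w = 0"; simp add: power2_eq_square divide_le_eq mult_left_mono)+
    then show thesis
      using result[of a "a\<^sup>2 / w"] a R psd True w by (simp add: e_def inv)
  next
    case False
    then have ea: "0 < e a" by simp
    have w: "0 < w" using ea Xx a w by (cases "w = 0") (auto simp: e_def)
    \<comment> \<open>Nonnegative excess means that \<open>\<beta> = X - x + z\<close> is at least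
      \<open>z\<^sup>2 / w\<close>; this choice leaves the second moment \<open>x - z\<close>, the
      largest allowed.\<close>
    have finish: thesis if z: "0 \<le> z" "z \<le> w" "0 \<le> e z" "x - z + v - t \<le> R" "R \<le> x - z"
      "psd3 t (x - z) v (x - z) R Q" for z
    proof (rule result[of z "X - x + z"])
      have "z\<^sup>2 / w \<le> X - x + z" using z(3) by (simp add: e_def)
      then show "z\<^sup>2 \<le> w * (X - x + z)" using w by (simp add: divide_le_eq mult.commute)
      have "0 \<le> z\<^sup>2 / w" using w by simp
      with \<open>z\<^sup>2 / w \<le> X - x + z\<close> show "0 \<le> X - x + z" by linarith
    qed (use z Xx in auto)
    have e_ends: "e 0 \<le> 0" "e w \<le> 0" using Xx w by (auto simp: e_def power2_eq_square)
    have e_cont: "continuous_on S e" for S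
      using w unfolding e_def by (intro continuous_intros) auto
    have e_diff: "e a - e z = (z - a) * ((z + a) / w - 1)" for z
      using w by (simp add: e_def field_simps power2_eq_square)
    show thesis
    proof (cases "t = 0")
      case True
      \<comment> \<open>Without mass on \<open>(1, 1)\<close> the McCormick inequalities leave no
        moments there.\<close>
      then have *: "x - a = 0" "v = 0" "R = 0" using R by auto
      have "0 \<le> Q" using psd[unfolded psd3_def, rule_format, of 0 0 1] by simp
      then have "psd3 t (x - a) v (x - a) R Q" unfolding * True by (simp add: psd3_def)
      then show thesis using finish[of a] a ea R by simp
    next
      case False
      then have t: "0 < t" using t by simp
      define A B where "A = t * (X - a\<^sup>2 / w) - (x - a)\<^sup>2" and "B = t * Q - v\<^sup>2"
      have AB: "0 \<le> A" "0 \<le> B" "(t * R - (x - a) * v)\<^sup>2 \<le> A * B"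
        using psd unfolding psd3_iff_schur[OF t] inv by (auto simp: A_def B_def)
      have A_eq: "A = t * (x - a + e a) - (x - a)\<^sup>2" by (simp add: A_def e_def)
      have bounds: "0 \<le> x - a" "x - a \<le> t" "0 \<le> v" "v \<le> t" using R by auto
      have psd_z: "psd3 t (x - z) v (x - z) R Q"
        if "0 \<le> x - z" "x - z \<le> t" "(t * R - (x - z) * v)\<^sup>2 \<le> (t * (x - z) - (x - z)\<^sup>2) * B" for z
      proof -
        have "0 \<le> (x - z) * (t - (x - z))" using that by simp
        then have "0 \<le> t * (x - z) - (x - z)\<^sup>2" by (simp add: algebra_simps power2_eq_square)
        then show ?thesis using that AB unfolding psd3_iff_schur[OF t] B_def by simp
      qed
      have psd_0: "psd3 t (x - z) v (x - z) R Q"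
        if "0 \<le> x - z" "x - z \<le> t" "t * R = (x - z) * v" for z
      proof (rule psd_z[OF that(1,2)])
        have "t * (x - z) - (x - z)\<^sup>2 = (x - z) * (t - (x - z))"
          by (simp add: algebra_simps power2_eq_square)
        then show "(t * R - (x - z) * v)\<^sup>2 \<le> (t * (x - z) - (x - z)\<^sup>2) * B"
          using that AB by simp
      qed
      \<comment> \<open>The value of \<open>a\<close> at which the covariance vanishes, provided
        \<open>v\<close> is nonzero, as in both strict cases below.\<close>
      define k where "k = x - t * R / v"
      consider "t * R = (x - a) * v" | "t * R < (x - a) * v" | "(x - a) * v < t * R" by linarith
      then show thesis
      proof cases
        case 1
        then show thesis using finish[of a] a ea R bounds psd_0 by simp
      next
        case 2
        have "0 \<le> t * R" using t R by simp
        then have "0 < (x - a) * v" using 2 by linarith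
        then have pos: "0 < x - a" "0 < v" using bounds by (auto simp: zero_less_mult_iff)
        have ak: "a < k" using 2 pos by (simp add: k_def field_simps)
        have k: "(x - k) * v = t * R" using pos by (simp add: k_def)
        \<comment> \<open>Increase \<open>a\<close> towards \<open>min w k\<close>. If the excess is
          nonpositive there, it has a zero on the way; otherwise \<open>k\<close> comes before
          \<open>w\<close>, because the excess at \<open>w\<close> is nonpositive.\<close>
        have "\<exists>z\<ge>a. z \<le> min w k \<and> (e z = 0 \<or> z = k \<and> 0 \<le> e z)"
        proof (cases "e (min w k) \<le> 0")
          case True
          then show ?thesis
            using IVT2'[of e "min w k" 0 a] ea a ak e_cont by auto
        next
          case False
          then have "min w k = k" using e_ends by (auto simp: min_def)
          then show ?thesis using False ak by (intro exI[of _ k]) auto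
        qed
        then obtain z where z: "a \<le> z" "z \<le> w" "z \<le> k" "e z = 0 \<or> z = k \<and> 0 \<le> e z" by auto
        \<comment> \<open>The covariance has not changed sign before \<open>k\<close>; with
          \<open>v \<le> t\<close> this gives the McCormick bound
          \<open>R \<le> x - z\<close>.\<close>
        have Rz: "t * R \<le> (x - z) * v"
          unfolding k[symmetric] using z pos by (intro mult_right_mono) auto
        have xz: "0 \<le> x - z"
          using Rz \<open>0 \<le> t * R\<close> pos by (smt (verit) mult_neg_pos)
        have "t * R \<le> t * (x - z)"
          using Rz mult_left_mono[OF bounds(4) xz] by (simp add: mult.commute)
        then have "R \<le> x - z" using t by simp
        moreover have "psd3 t (x - z) v (x - z) R Q"
          using z(4)
        proof (elim disjE conjE)
          assume "e z = 0"
          \<comment> \<open>At a zero of the excess, \<open>e a\<close> is at most the distance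
            moved, which is the bound on \<open>A\<close> required by
            \<open>schur_shift_down\<close>.\<close>
          then have "e a = (z - a) * ((z + a) / w - 1)" using e_diff[of z] by simp
          also have "\<dots> \<le> (z - a) * 1"
            using z a w by (intro mult_left_mono) (auto simp: divide_le_eq)
          finally have "t * (x - a + e a) \<le> t * (2 * (x - a) - (x - z))"
            using t by (intro mult_left_mono) auto
          then have "A \<le> t * (2 * (x - a) - (x - z)) - (x - a)\<^sup>2" unfolding A_eq by simp
          then show ?thesis
            using z bounds xz pos R Rz AB
            by (intro psd_z schur_shift_down[OF t]) auto
        next
          assume "z = k"
          then show ?thesis using k xz z bounds by (intro psd_0) auto
        qed
        ultimately show thesis using finish[of z] z a R by auto
      next
        case 3
        have "0 \<le> (x - a) * v" using bounds by simp
        then have "0 < t * R" using 3 by linarith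
        then have v: "0 < v" using R t by (auto simp: zero_less_mult_iff)
        have "t * R \<le> t * v" using R t by simp
        then have "(x - a) * v < t * v" using 3 by linarith
        then have xa: "x - a < t" using v by simp
        have ak: "k < a" using 3 v by (simp add: k_def field_simps)
        have k: "(x - k) * v = t * R" using v by (simp add: k_def)
        have "\<exists>z\<le>a. max 0 k \<le> z \<and> (e z = 0 \<or> z = k \<and> 0 \<le> e z)"
        proof (cases "e (max 0 k) \<le> 0")
          case True
          then show ?thesis
            using IVT'[of e "max 0 k" 0 a] ea a ak e_cont by auto
        next
          case False
          then have "max 0 k = k" using e_ends by (auto simp: max_def split: if_splits)
          then show ?thesis using False ak by (intro exI[of _ k]) auto
        qed
        then obtain z where z: "z \<le> a" "0 \<le> z" "k \<le> z" "e z = 0 \<or> z = k \<and> 0 \<le> e z" by auto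
        have Rz: "(x - z) * v \<le> t * R"
          unfolding k[symmetric] using z v by (intro mult_right_mono) auto
        then have "(x - z) * v \<le> t * v" using \<open>t * R \<le> t * v\<close> by linarith
        then have xz: "x - z \<le> t" using v by simp
        \<comment> \<open>Decreasing \<open>a\<close> endangers the lower McCormick bound, which
          follows from this product together with \<open>Rz\<close>.\<close>
        have "0 \<le> (t - (x - z)) * (t - v)" using xz bounds by simp
        then have "t * (x - z + v - t) \<le> (x - z) * v" by (simp add: algebra_simps)
        then have "t * (x - z + v - t) \<le> t * R" using Rz by linarith
        then have "x - z + v - t \<le> R" using t by simp
        moreover have "psd3 t (x - z) v (x - z) R Q"
          using z(4)
        proof (elim disjE conjE)
          assume "e z = 0"
          then have "e a = (a - z) * (1 - (z + a) / w)"
            using e_diff[of z] minus_mult_minus[of "z - a" "(z + a) / w - 1"] by simp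
          also have "\<dots> \<le> (a - z) * 1"
            using z a w by (intro mult_left_mono) auto
          finally have "t * (x - a + e a) \<le> t * (x - z)"
            using t by (intro mult_left_mono) auto
          then have "A \<le> t * (x - z) - (x - a)\<^sup>2" unfolding A_eq by simp
          then show ?thesis
            using z bounds xz xa R Rz AB
            by (intro psd_z schur_shift_up[OF t]) auto
        next
          assume "z = k"
          then show ?thesis using k xz z bounds by (intro psd_0) auto
        qed
        ultimately show thesis using finish[of z] z a R by auto
      qed
    qed
  qed
qed

section \<open>Assembling the decomposition by the value of y\<close>

text \<open>Contributions of probability mass \<open>t\<close>. They add without normalization, and
  a zero mass contributes only the zero point.\<close>

definition hull_multiple :: "real \<Rightarrow> ((real^2) \<times> (real^2^2) \<times> (real^2) \<times> real) set" where
  "hull_multiple t = (*\<^sub>R) t ` switching_hull"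

lemma hull_multiple_add:
  assumes "p \<in> hull_multiple s" "q \<in> hull_multiple t" "0 \<le> s" "0 \<le> t"
  shows "p + q \<in> hull_multiple (s + t)"
proof -
  obtain h k where h: "h \<in> switching_hull" "p = s *\<^sub>R h" and k: "k \<in> switching_hull" "q = t *\<^sub>R k"
    using assms unfolding hull_multiple_def by blast
  show ?thesis
  proof (cases "s + t = 0")
    case True
    then have "s = 0" "t = 0" using assms by auto
    then show ?thesis using h k unfolding hull_multiple_def by auto
  next
    case False
    then have "(s / (s + t)) *\<^sub>R h + (t / (s + t)) *\<^sub>R k \<in> switching_hull"
      using h k assms by (intro switching_hull_convexD) (auto simp: add_divide_distrib[symmetric])
    moreover have "p + q = (s + t) *\<^sub>R ((s / (s + t)) *\<^sub>R h + (t / (s + t)) *\<^sub>R k)"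
      using False h k by (simp add: scaleR_add_right)
    ultimately show ?thesis unfolding hull_multiple_def by blast
  qed
qed

lemma switching_point_zero_mem: "switching_point 0 0 0 0 0 0 0 0 \<in> hull_multiple t"
proof -
  have "switching_point 0 0 0 0 0 0 0 0 \<in> switching_hull"
    using switching_point_generator[of 0 0 0 0] by simp
  then show ?thesis
    unfolding hull_multiple_def
    by (intro image_eqI[of _ _ "switching_point 0 0 0 0 0 0 0 0"]) (simp add: switching_point_scaleR)
qed

text \<open>Dividing by \<open>t\<close> reduces this to \<open>box_hull\<close>. For
  \<open>t = 0\<close> the McCormick inequalities and the nonnegative diagonal force every moment to
  be zero.\<close>

lemma both_on_mem:
  assumes t: "0 \<le> t" and psd: "psd3 t u v P R Q" and PQ: "P \<le> u" "Q \<le> v"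
    and R: "0 \<le> R" "u + v - t \<le> R" "R \<le> u" "R \<le> v"
  shows "switching_point u v P R Q t t t \<in> hull_multiple t"
proof (cases "t = 0")
  case True
  have "0 \<le> P" "0 \<le> Q"
    using psd[unfolded psd3_def, rule_format, of 0 1 0] psd[unfolded psd3_def, rule_format, of 0 0 1]
    by auto
  then have "u = 0" "v = 0" "P = 0" "Q = 0" "R = 0" using True R PQ by auto
  then show ?thesis using True switching_point_zero_mem by simp
next
  case False
  then have t: "0 < t" using t by simp
  have "psd3 1 (u / t) (v / t) (P / t) (R / t) (Q / t)"
    \<comment> \<open>The second weight is 0, so the combination is a mere rescaling.\<close>
    using psd3_convex[OF psd psd, of "1 / t" 0] t by simp
  moreover have "u / t + v / t - 1 \<le> R / t"
    using divide_right_mono[OF R(2), of t] t by (simp add: add_divide_distrib diff_divide_distrib)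
  ultimately have "switching_point (u / t) (v / t) (P / t) (R / t) (Q / t) 1 1 1 \<in> switching_hull"
    using R PQ t by (intro box_hull) (auto simp: divide_right_mono)
  moreover have "switching_point u v P R Q t t t
      = t *\<^sub>R switching_point (u / t) (v / t) (P / t) (R / t) (Q / t) 1 1 1"
    using t by (simp add: switching_point_scaleR)
  ultimately show ?thesis unfolding hull_multiple_def by blast
qed

lemma one_on_mem:
  assumes a: "0 \<le> a" "a \<le> w" and \<beta>: "a\<^sup>2 \<le> w * \<beta>" "0 \<le> \<beta>" "\<beta> \<le> a"
  shows "switching_point a 0 \<beta> 0 0 w 0 0 \<in> hull_multiple w"
    and "switching_point 0 a 0 0 \<beta> 0 w 0 \<in> hull_multiple w"
proof -
  have "switching_point a 0 \<beta> 0 0 w 0 0 \<in> hull_multiple w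
      \<and> switching_point 0 a 0 0 \<beta> 0 w 0 \<in> hull_multiple w"
  proof (cases "w = 0")
    case True
    then have "a = 0" "\<beta> = 0" using assms by auto
    then show ?thesis using True switching_point_zero_mem by simp
  next
    case False
    then have w: "0 < w" using a by simp
    have *: "(a / w)\<^sup>2 \<le> \<beta> / w" "\<beta> / w \<le> a / w" "0 \<le> a / w" "a / w \<le> 1"
      using w a \<beta> by (auto simp: power2_eq_square field_simps)
    have "switching_point (a / w) 0 (\<beta> / w) 0 0 1 0 0 \<in> switching_hull"
      "switching_point 0 (a / w) 0 0 (\<beta> / w) 0 1 0 \<in> switching_hull"
      using * switching_point_diag[of 1 0 "a / w" 0 "\<beta> / w" 0]
        switching_point_diag[of 0 1 0 "a / w" 0 "\<beta> / w"] by auto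
    moreover have
      "switching_point a 0 \<beta> 0 0 w 0 0 = w *\<^sub>R switching_point (a / w) 0 (\<beta> / w) 0 0 1 0 0"
      "switching_point 0 a 0 0 \<beta> 0 w 0 = w *\<^sub>R switching_point 0 (a / w) 0 0 (\<beta> / w) 0 1 0"
      using w by (auto simp: switching_point_scaleR)
    ultimately show ?thesis unfolding hull_multiple_def by blast
  qed
  then show "switching_point a 0 \<beta> 0 0 w 0 0 \<in> hull_multiple w"
    "switching_point 0 a 0 0 \<beta> 0 w 0 \<in> hull_multiple w" by auto
qed

lemma lifted_set_projects_into_switching_hull:
  assumes "(x, X, y, t, \<alpha>) \<in> lifted_set"
  shows "(x, X, y, t) \<in> switching_hull"
proof -
  note L = assms[unfolded mem_lifted_set_iff]
  define w1 w2 where "w1 = y $ 1 - t" and "w2 = y $ 2 - t"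
  have first: "0 \<le> \<alpha> $ 1" "\<alpha> $ 1 \<le> w1" "X $ 1 $ 1 \<le> x $ 1" "0 \<le> t" "0 \<le> X $ 1 $ 2"
      "x $ 1 - \<alpha> $ 1 + (x $ 2 - \<alpha> $ 2) - t \<le> X $ 1 $ 2"
      "X $ 1 $ 2 \<le> x $ 1 - \<alpha> $ 1" "X $ 1 $ 2 \<le> x $ 2 - \<alpha> $ 2"
      "psd3 t (x $ 1 - \<alpha> $ 1) (x $ 2 - \<alpha> $ 2) (X $ 1 $ 1 - inverse w1 * (\<alpha> $ 1)\<^sup>2) (X $ 1 $ 2)
        (X $ 2 $ 2 - inverse w2 * (\<alpha> $ 2)\<^sup>2)"
    using L by (auto simp: w1_def w2_def)
  obtain a1 b1 where 1: "0 \<le> a1" "a1 \<le> w1" "a1\<^sup>2 \<le> w1 * b1" "0 \<le> b1" "b1 \<le> a1"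
      "X $ 1 $ 1 - b1 \<le> x $ 1 - a1" "x $ 1 - a1 + (x $ 2 - \<alpha> $ 2) - t \<le> X $ 1 $ 2"
      "X $ 1 $ 2 \<le> x $ 1 - a1"
      "psd3 t (x $ 1 - a1) (x $ 2 - \<alpha> $ 2) (X $ 1 $ 1 - b1) (X $ 1 $ 2)
        (X $ 2 $ 2 - inverse w2 * (\<alpha> $ 2)\<^sup>2)"
    by (rule shift_switch_mass[OF first])
  \<comment> \<open>The first shift preserved semidefiniteness and the McCormick inequalities, so
    the second coordinate can be shifted with the roles exchanged; this leaves
    \<open>X $ 1 $ 1 - b1 \<le> x $ 1 - a1\<close> untouched.\<close>
  have second: "0 \<le> \<alpha> $ 2" "\<alpha> $ 2 \<le> w2" "X $ 2 $ 2 \<le> x $ 2" "0 \<le> t" "0 \<le> X $ 1 $ 2"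
      "x $ 2 - \<alpha> $ 2 + (x $ 1 - a1) - t \<le> X $ 1 $ 2"
      "X $ 1 $ 2 \<le> x $ 2 - \<alpha> $ 2" "X $ 1 $ 2 \<le> x $ 1 - a1"
      "psd3 t (x $ 2 - \<alpha> $ 2) (x $ 1 - a1) (X $ 2 $ 2 - inverse w2 * (\<alpha> $ 2)\<^sup>2) (X $ 1 $ 2)
        (X $ 1 $ 1 - b1)"
    using L 1(6-8) psd3_commute[THEN iffD1, OF 1(9)] by (auto simp: w2_def)
  obtain a2 b2 where 2: "0 \<le> a2" "a2 \<le> w2" "a2\<^sup>2 \<le> w2 * b2" "0 \<le> b2" "b2 \<le> a2"
      "X $ 2 $ 2 - b2 \<le> x $ 2 - a2" "x $ 2 - a2 + (x $ 1 - a1) - t \<le> X $ 1 $ 2"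
      "X $ 1 $ 2 \<le> x $ 2 - a2"
      "psd3 t (x $ 2 - a2) (x $ 1 - a1) (X $ 2 $ 2 - b2) (X $ 1 $ 2) (X $ 1 $ 1 - b1)"
    by (rule shift_switch_mass[OF second])
  \<comment> \<open>The mass of \<open>y = (0, 0)\<close>, which is
    \<open>1 - y $ 1 - y $ 2 + t\<close> and hence nonnegative by constraint (iv).\<close>
  define w0 where "w0 = 1 - w1 - w2 - t"
  have w: "0 \<le> w1" "0 \<le> w2" "0 \<le> w0" "0 \<le> t" using L by (auto simp: w0_def w1_def w2_def)
  have "switching_point (x $ 1 - a1) (x $ 2 - a2) (X $ 1 $ 1 - b1) (X $ 1 $ 2) (X $ 2 $ 2 - b2) t t t
      \<in> hull_multiple t"
    using 1(6-8) 2(6-8) psd3_commute[THEN iffD1, OF 2(9)] L by (intro both_on_mem) simp_all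
  then have "switching_point (x $ 1 - a1) (x $ 2 - a2) (X $ 1 $ 1 - b1) (X $ 1 $ 2) (X $ 2 $ 2 - b2) t t t
      + switching_point a1 0 b1 0 0 w1 0 0 + switching_point 0 a2 0 0 b2 0 w2 0
      + switching_point 0 0 0 0 0 0 0 0 \<in> hull_multiple (t + w1 + w2 + w0)"
    using 1 2 w by (intro hull_multiple_add one_on_mem switching_point_zero_mem) auto
  moreover have "(x, X, y, t) =
      switching_point (x $ 1 - a1) (x $ 2 - a2) (X $ 1 $ 1 - b1) (X $ 1 $ 2) (X $ 2 $ 2 - b2) t t t
      + switching_point a1 0 b1 0 0 w1 0 0 + switching_point 0 a2 0 0 b2 0 w2 0
      + switching_point 0 0 0 0 0 0 0 0"
    unfolding switching_point_add
    using L by (simp add: switching_point_def vec_eq_iff forall_2 w1_def w2_def)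
  ultimately have "(x, X, y, t) \<in> hull_multiple 1" by (simp add: w0_def)
  then show ?thesis by (simp add: hull_multiple_def)
qed

theorem theorem4:
  shows "switching_hull = (\<lambda>(x, X, y, Y12, \<alpha>). (x, X, y, Y12)) ` lifted_set"
proof
  show "switching_hull \<subseteq> (\<lambda>(x, X, y, Y12, \<alpha>). (x, X, y, Y12)) ` lifted_set"
    by (rule switching_hull_subset)
  show "(\<lambda>(x, X, y, Y12, \<alpha>). (x, X, y, Y12)) ` lifted_set \<subseteq> switching_hull"
    using lifted_set_projects_into_switching_hull by auto
qed

end
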